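(* Let $(X,d)$ be a nonempty compact metric space and let $T : X \to X$ be a significant pointwise shrinking (SPS) mapping, i.e. for all $x,y \in X$, $0 < d(y,x) \leq d(x,Tx)$ implies $d(Tx,Ty) < d(x,y)$. Then $T$ has a fixed point, i.e. there exists $u \in X$ with $Tu = u$.
   Context: Let $(X,d)$ be a metric space. A mapping $T : X \to X$ is called significant pointwise shrinking (SPS) if, for all $x,y \in X$, $0 < d(y,x) \leq d(x,Tx)$ implies $d(Tx,Ty) < d(x,y)$. Continuity of $T$ is not assumed. *)

theory Defs
  imports "HOL-Analysis.Analysis"
begin

definition SPS :: "'a set \<Rightarrow> ('a \<Rightarrow> 'a \<Rightarrow> real) \<Rightarrow> ('a \<Rightarrow> 'a) \<Rightarrow> bool" where
  "SPS X d T \<longleftrightarrow> T \<in> X \<rightarrow> X \<and>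
     (\<forall>x\<in>X. \<forall>y\<in>X. 0 < d y x \<and> d y x \<le> d x (T x) \<longrightarrow> d (T x) (T y) < d x y)"

end

theory Submission
  imports Defs
begin

text \<open>
  If \<open>x\<close> is not fixed, the shrinking condition applies to every \<open>y \<noteq> x\<close> with
  \<open>d x y \<le> d x (T x)\<close>, so \<open>T\<close> is nonexpansive towards \<open>x\<close> on a neighbourhood of \<open>x\<close>.
  Hence a map without fixed points has a continuous displacement \<open>d x (T x)\<close>, which attains a
  positive minimum at some \<open>a\<close>; but taking \<open>y = T a\<close> shows that \<open>T a\<close> has a smaller displacement.
\<close>

lemma SPS_displacement_continuous:
  assumes "Metric_space X d" and sps: "SPS X d T" and nofix: "\<And>x. x \<in> X \<Longrightarrow> T x \<noteq> x"
  shows "continuous_map (Metric_space.mtopology X d) euclideanreal (\<lambda>x. d x (T x))"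
proof -
  interpret Metric_space X d by fact
  have TX: "T x \<in> X" if "x \<in> X" for x
    using sps that by (auto simp: SPS_def)
  have "\<exists>U. openin mtopology U \<and> x \<in> U \<and> (\<forall>y\<in>U. d y (T y) \<in> Met_TC.mball (d x (T x)) e)"
    if x: "x \<in> X" and e: "e > 0" for x e
  proof (intro exI conjI ballI)
    \<comment> \<open>The bound \<open>d x (T x)\<close> lets \<open>SPS\<close> apply at
      \<open>x\<close> to every other point of the ball; \<open>e / 2\<close> is used because moving
      from \<open>x\<close> to \<open>y\<close> costs two distances, each at most
      \<open>d x y\<close>.\<close>
    define s where "s = min (d x (T x)) (e / 2)"
    have s: "s > 0"
      using x e nofix[OF x] TX[OF x] by (simp add: s_def)
    show "openin mtopology (mball x s)" "x \<in> mball x s"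
      using x s by simp_all
    fix y assume "y \<in> mball x s"
    then have y: "y \<in> X" "d x y < d x (T x)" "d x y < e / 2"
      by (auto simp: s_def)
    have shrink: "d (T x) (T y) \<le> d x y"
    proof (cases "y = x")
      case False
      then have "0 < d y x" using x y by simp
      then show ?thesis
        using sps x y commute[of y x] by (force simp: SPS_def)
    qed (use x TX in simp)
    \<comment> \<open>Going round the quadrilateral \<open>x\<close>, \<open>y\<close>,
      \<open>T y\<close>, \<open>T x\<close> both ways, the displacements differ by at most
      \<open>d x y + d (T x) (T y)\<close>, hence by less than \<open>e\<close>.\<close>
    have "d x (T x) \<le> d x y + d y (T y) + d (T x) (T y)"
      using triangle[OF x y(1) TX[OF x]] triangle[OF y(1) TX[OF y(1)] TX[OF x]]
        commute[of "T x" "T y"] by simp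
    moreover have "d y (T y) \<le> d x y + d x (T x) + d (T x) (T y)"
      using triangle[OF y(1) x TX[OF y(1)]] triangle[OF x TX[OF x] TX[OF y(1)]]
        commute[of x y] by simp
    ultimately show "d y (T y) \<in> Met_TC.mball (d x (T x)) e"
      using shrink y by (simp add: dist_real_def abs_less_iff)
  qed
  then show ?thesis
    using Met_TC.continuous_map_to_metric[of mtopology "\<lambda>x. d x (T x)"] by simp
qed

theorem theorem2p3:
  fixes X :: "'a set" and d :: "'a \<Rightarrow> 'a \<Rightarrow> real" and T :: "'a \<Rightarrow> 'a"
  assumes "Metric_space X d"
    and "X \<noteq> {}"
    and "compact_space (Metric_space.mtopology X d)"
    and "SPS X d T"
  shows "\<exists>u\<in>X. T u = u"
proof (rule ccontr)
  assume "\<not> ?thesis"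
  then have nofix: "\<And>x. x \<in> X \<Longrightarrow> T x \<noteq> x" by blast
  interpret Metric_space X d by fact
  let ?r = "\<lambda>x. d x (T x)"
  have "continuous_map mtopology euclideanreal ?r"
    using SPS_displacement_continuous[OF assms(1,4) nofix] by simp
  moreover have "compactin mtopology X"
    using assms(3) by (simp add: compact_space_def)
  ultimately have "compact (?r ` X)"
    using image_compactin by fastforce
  then obtain a where a: "a \<in> X" "\<And>x. x \<in> X \<Longrightarrow> ?r a \<le> ?r x"
    using compact_attains_inf[of "?r ` X"] assms(2) by auto
  have Ta: "T a \<in> X"
    using assms(4) a by (auto simp: SPS_def)
  have "0 < d (T a) a"
    using a Ta nofix by simp
  \<comment> \<open>By symmetry \<open>y = T a\<close> meets the condition
    \<open>d y a \<le> d a (T a)\<close> with equality.\<close>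
  then have "?r (T a) < ?r a"
    using assms(4) a Ta commute[of "T a" a] by (simp add: SPS_def)
  then show False
    using a(2)[OF Ta] by simp
qed

end
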